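(* Let $n\ge 2$ be an integer and let $f_1,f_2,f_3,\dots$ be independent random functions, each uniformly distributed over the $n^n$ functions from $[n]=\{1,\dots,n\}$ to $[n]$. Put $g_1=f_1$ and $g_t=f_t\circ g_{t-1}$ for $t>1$. For $m\ge 1$ let $\tau_m=|\{t\ge 1: |\mathrm{Range}(g_t)|=m\}|$. Let $\xi=\lfloor \log\log n\rfloor$, $T_1=\sum_{m=2}^{\xi}\tau_m$, and let $\mathcal A=\bigcap_{m=1}^{\xi}[\tau_m>0]$ be the event that $\tau_m>0$ for every $m\in\{1,\dots,\xi\}$. For $k\ge 1$ let $\lambda_k=\prod_{j=1}^{k-1}\left(1-\frac{j}{n}\right)$. Then, for every real $t$ (whenever $\Pr(\mathcal A)>0$ so that the conditional expectation is defined), $$E\left(e^{itT_1}\,\middle|\,\mathcal A\right)=e^{it(\xi-1)}\prod_{k=2}^{\xi}\frac{1-\lambda_k}{1-\lambda_k e^{it}}.$$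
   Context: $i$ denotes the imaginary unit. $\mathrm{Range}(g)$ is the image set of a function $g$.
   Formalization: The formal theorem also assumes ξ ≥ 1 (i.e. n ≥ 16): for 2 ≤ n ≤ 15 one has ξ ≤ 0, so T_1 = 0 and A is certain, the left side is 1 while the right side is e^{it(ξ-1)} ≠ 1 in general, so the claim fails there. *)

theory Defs
  imports "HOL-Probability.Probability"
begin

abbreviation self_maps :: "nat \<Rightarrow> (nat \<Rightarrow> nat) set"
  where "self_maps n \<equiv> {1..n} \<rightarrow>\<^sub>E {1..n}"

text \<open>The sequence of compositions is indexed from 1, as is \<open>\<phi>\<close>; the value at 0 is never used.\<close>

fun g :: "nat \<Rightarrow> (nat \<Rightarrow> nat \<Rightarrow> nat) \<Rightarrow> nat \<Rightarrow> nat \<Rightarrow> nat" where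
  "g n \<phi> 0 = (\<lambda>x\<in>{1..n}. x)"
| "g n \<phi> (Suc 0) = \<phi> 1"
| "g n \<phi> (Suc (Suc t)) = compose {1..n} (\<phi> (Suc (Suc t))) (g n \<phi> (Suc t))"

text \<open>Counting measure rather than \<open>card\<close>: the set of times may be infinite (almost surely it is
  for \<open>m = 1\<close>), in which case the value must be \<open>\<infinity>\<close> and not 0.\<close>

definition \<tau> :: "nat \<Rightarrow> (nat \<Rightarrow> nat \<Rightarrow> nat) \<Rightarrow> nat \<Rightarrow> ennreal"
  where "\<tau> n \<phi> m = emeasure (count_space UNIV) {t. 1 \<le> t \<and> card (g n \<phi> t ` {1..n}) = m}"

definition \<xi> :: "nat \<Rightarrow> int"
  where "\<xi> n = \<lfloor>ln (ln (real n))\<rfloor>"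

definition T\<^sub>1 :: "nat \<Rightarrow> (nat \<Rightarrow> nat \<Rightarrow> nat) \<Rightarrow> ennreal"
  where "T\<^sub>1 n \<phi> = (\<Sum>m = 2..nat (\<xi> n). \<tau> n \<phi> m)"

definition all_visited :: "'a measure \<Rightarrow> nat \<Rightarrow> (nat \<Rightarrow> 'a \<Rightarrow> nat \<Rightarrow> nat) \<Rightarrow> 'a set"
  where "all_visited M n f = {\<omega> \<in> space M. \<forall>m\<in>{1..nat (\<xi> n)}. \<tau> n (\<lambda>t. f t \<omega>) m > 0}"

definition lam :: "nat \<Rightarrow> nat \<Rightarrow> real"
  where "lam n k = (\<Prod>j = 1..<k. 1 - real j / real n)"

text \<open>Elementary conditional expectation given an event \<open>A\<close> of positive probability:
  \<open>uniform_measure M A\<close> is the conditional measure \<open>B \<mapsto> P (A \<inter> B) / P A\<close>.\<close>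

definition expectation_given :: "'a measure \<Rightarrow> ('a \<Rightarrow> complex) \<Rightarrow> 'a set \<Rightarrow> complex"
  where "expectation_given M X A = (\<integral>\<omega>. X \<omega> \<partial>uniform_measure M A)"

end

theory Submission
  imports Defs
begin

text \<open>
  The size \<open>R\<^sub>s\<close> of the range of \<open>g\<^sub>s\<close> is a nonincreasing Markov chain started at \<open>R\<^sub>0 = n\<close>, and it
  stays at \<open>k\<close> with probability \<open>\<lambda>\<^sub>k\<close>. Write \<open>K = \<xi>\<close> and \<open>z = exp (\<i>t)\<close>, and give a step from \<open>k\<close> to \<open>j\<close> the weight
  0 if it jumps over some level in \<open>{1..K}\<close>, otherwise \<open>z\<close> if \<open>j\<close> lies in \<open>{2..K}\<close> and 1 if not. The product
  of the weights along a whole trajectory is \<open>z\<close> to the power \<open>T\<^sub>1\<close> on the event that all levels are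
  visited, and 0 off it. Let \<open>\<Phi>\<^sub>z\<close> solve the first-step equations with \<open>\<Phi>\<^sub>z(1) = 1\<close>. Then the weight up to
  time \<open>s\<close> times \<open>\<Phi>\<^sub>z(R\<^sub>s)\<close> is a bounded martingale, so the expected total weight is \<open>\<Phi>\<^sub>z(n)\<close>.
  Below \<open>K\<close> only unit steps down have nonzero weight and \<open>\<Phi>\<^sub>z(K)\<close> is an explicit product; above \<open>K\<close> the
  weights do not involve \<open>z\<close>, so \<open>\<Phi>\<^sub>z(n)\<close> is this product times a factor independent of \<open>z\<close>, which cancels
  in the quotient \<open>\<Phi>\<^sub>z(n) / \<Phi>\<^sub>1(n)\<close>.
\<close>

section \<open>Counting functions between finite sets\<close>

lemma sum_PiE_insert:
  fixes G :: "('i \<Rightarrow> 'b) \<Rightarrow> 'c::comm_monoid_add"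
  assumes "x \<notin> S"
  shows "(\<Sum>a\<in>PiE (insert x S) F. G a) = (\<Sum>a\<in>PiE S F. \<Sum>y\<in>F x. G (a(x := y)))"
proof -
  have "(\<Sum>a\<in>PiE (insert x S) F. G a) = (\<Sum>(y, a)\<in>F x \<times> PiE S F. G (a(x := y)))"
    unfolding PiE_insert_eq
    by (subst sum.reindex[OF inj_combinator[OF assms]]) (simp add: case_prod_beta o_def)
  also have "\<dots> = (\<Sum>y\<in>F x. \<Sum>a\<in>PiE S F. G (a(x := y)))"
    by (rule sum.cartesian_product[symmetric])
  finally show ?thesis by (simp add: sum.swap[of _ "F x"])
qed

text \<open>Values on \<open>S\<close> are chosen one after another, each avoiding the earlier ones,
  and values off \<open>S\<close> are free. Accordingly there are two inductions: the outer one adds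
  points outside \<open>S\<close>, and its base case is an induction over \<open>S\<close>
  itself.\<close>

lemma card_PiE_inj_on_subset:
  assumes "finite X" "finite Y" "S \<subseteq> X"
  shows "card {h \<in> X \<rightarrow>\<^sub>E Y. inj_on h S} = (\<Prod>j<card S. card Y - j) * card Y ^ (card X - card S)"
proof -
  have fS: "finite S" using assms finite_subset by blast
  have main: "finite D \<Longrightarrow> D \<inter> S = {} \<Longrightarrow>
      (\<Sum>h\<in>(D \<union> S) \<rightarrow>\<^sub>E Y. of_bool (inj_on h S)) = (\<Prod>j<card S. card Y - j) * card Y ^ card D" for D
  proof (induction D rule: finite_induct)
    case empty
    have "card {h \<in> S \<rightarrow>\<^sub>E Y. inj_on h S} = (\<Prod>j<card S. card Y - j)"
      using fS
    proof (induction S rule: finite_induct)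
      case empty
      then show ?case by simp
    next
      case (insert x F)
      have "card {h \<in> insert x F \<rightarrow>\<^sub>E Y. inj_on h (insert x F)} =
          (\<Sum>h\<in>F \<rightarrow>\<^sub>E Y. \<Sum>y\<in>Y. of_bool (inj_on (h(x := y)) (insert x F)))"
        using insert.hyps \<open>finite Y\<close>
        by (subst sum_PiE_insert[symmetric])
          (auto simp: finite_PiE Int_def intro!: arg_cong[where f = card])
      also have "\<dots> = (\<Sum>h\<in>F \<rightarrow>\<^sub>E Y. of_bool (inj_on h F) * (card Y - card F))"
      proof (rule sum.cong[OF refl])
        fix h assume h: "h \<in> F \<rightarrow>\<^sub>E Y"
        have eq: "inj_on (h(x := y)) (insert x F) \<longleftrightarrow> inj_on h F \<and> y \<notin> h ` F" for y
          using insert.hyps by (auto simp: inj_on_def)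
        have "(\<Sum>y\<in>Y. of_bool (inj_on h F \<and> y \<notin> h ` F)) = of_bool (inj_on h F) * card (Y - h ` F)"
          using \<open>finite Y\<close> by (auto simp: Int_def Diff_eq intro!: arg_cong[where f = card])
        also have "\<dots> = of_bool (inj_on h F) * (card Y - card F)"
          using h insert.hyps by (auto simp: card_Diff_subset card_image image_subset_iff PiE_iff)
        finally show "(\<Sum>y\<in>Y. of_bool (inj_on (h(x := y)) (insert x F))) =
            of_bool (inj_on h F) * (card Y - card F)" by (simp only: eq)
      qed
      also have "\<dots> = card {h \<in> F \<rightarrow>\<^sub>E Y. inj_on h F} * (card Y - card F)"
        using insert.hyps \<open>finite Y\<close> by (simp flip: sum_distrib_right add: finite_PiE Int_def)
      finally show ?case using insert by (simp add: mult.commute)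
    qed
    then show ?case using fS \<open>finite Y\<close> by (simp add: finite_PiE Int_def)
  next
    case (insert x F)
    have "inj_on (h(x := y)) S = inj_on h S" for h :: "'a \<Rightarrow> 'b" and y
      using insert.prems by (auto simp: inj_on_def)
    then show ?case using insert \<open>finite Y\<close>
      by (simp add: sum_PiE_insert flip: sum_distrib_left)
  qed
  have "X = (X - S) \<union> S" "card (X - S) = card X - card S"
    using assms fS by (auto simp: card_Diff_subset)
  then show ?thesis using main[of "X - S"] assms
    by (auto simp: finite_PiE Int_def Diff_Int_distrib2)
qed

text \<open>Precomposition with a permutation of \<open>X\<close> that carries \<open>B\<close> onto
  \<open>A\<close> injects the first set of functions into the second. Exchanging \<open>A\<close>
  and \<open>B\<close> gives equality, so the law of the image size depends on the size of the set
  alone.\<close>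

lemma card_PiE_card_image_le:
  assumes "finite X" "finite Y" "A \<subseteq> X" "B \<subseteq> X" "card A = card B"
  shows "card {h \<in> X \<rightarrow>\<^sub>E Y. card (h ` A) = j} \<le> card {h \<in> X \<rightarrow>\<^sub>E Y. card (h ` B) = j}"
proof -
  have fin: "finite A" "finite B" using assms finite_subset by auto
  obtain p1 where p1: "bij_betw p1 B A"
    using finite_same_card_bij[OF fin(2,1)] assms by auto
  have "card (X - B) = card (X - A)" using assms fin by (simp add: card_Diff_subset)
  then obtain p2 where p2: "bij_betw p2 (X - B) (X - A)"
    using finite_same_card_bij[of "X - B" "X - A"] assms by auto
  define p where "p x = (if x \<in> B then p1 x else p2 x)" for x
  have pB: "bij_betw p B A" using p1 by (subst bij_betw_cong[of _ _ p1]) (auto simp: p_def)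
  have "bij_betw p (X - B) (X - A)" using p2 by (subst bij_betw_cong[of _ _ p2]) (auto simp: p_def)
  from bij_betw_combine[OF pB this] have p: "bij_betw p X X"
    using assms by (simp add: Un_absorb1)
  show ?thesis
  proof (rule card_inj_on_le)
    show "inj_on (\<lambda>h. compose X h p) {h \<in> X \<rightarrow>\<^sub>E Y. card (h ` A) = j}"
    proof (rule inj_onI)
      fix h h' assume h: "h \<in> {h \<in> X \<rightarrow>\<^sub>E Y. card (h ` A) = j}" "h' \<in> {h \<in> X \<rightarrow>\<^sub>E Y. card (h ` A) = j}"
        and eq: "compose X h p = compose X h' p"
      show "h = h'"
      proof (rule PiE_ext)
        show "h \<in> X \<rightarrow>\<^sub>E Y" "h' \<in> X \<rightarrow>\<^sub>E Y" using h by auto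
        fix x assume "x \<in> X"
        then obtain y where "y \<in> X" "x = p y" using p by (auto simp: bij_betw_def)
        then show "h x = h' x" using fun_cong[OF eq, of y] by (simp add: compose_def)
      qed
    qed
    show "(\<lambda>h. compose X h p) ` {h \<in> X \<rightarrow>\<^sub>E Y. card (h ` A) = j} \<subseteq> {h \<in> X \<rightarrow>\<^sub>E Y. card (h ` B) = j}"
    proof (rule image_subsetI)
      fix h assume h: "h \<in> {h \<in> X \<rightarrow>\<^sub>E Y. card (h ` A) = j}"
      have "compose X h p \<in> X \<rightarrow>\<^sub>E Y"
        using h p by (auto simp: compose_def bij_betw_def PiE_iff)
      moreover have "compose X h p ` B = h ` p ` B"
        using assms(4) by (force simp: compose_def)
      moreover have "p ` B = A" using pB by (simp add: bij_betw_def)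
      ultimately show "compose X h p \<in> {h \<in> X \<rightarrow>\<^sub>E Y. card (h ` B) = j}" using h by simp
    qed
    show "finite {h \<in> X \<rightarrow>\<^sub>E Y. card (h ` B) = j}"
      using assms by (auto intro!: finite_subset[OF _ finite_PiE[of X "\<lambda>_. Y"]])
  qed
qed

section \<open>Transition probabilities of the range size\<close>

definition trans_prob :: "nat \<Rightarrow> nat \<Rightarrow> nat \<Rightarrow> real"
  where "trans_prob n k j = card {h \<in> self_maps n. card (h ` {1..k}) = j} / n ^ n"

lemma finite_self_maps [simp]: "finite ({Suc 0..n} \<rightarrow>\<^sub>E {Suc 0..n})"
  by (simp add: finite_PiE)

lemma card_self_maps [simp]: "card ({Suc 0..n} \<rightarrow>\<^sub>E {Suc 0..n}) = n ^ n"
  by (simp add: card_funcsetE)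

text \<open>By symmetry the representative \<open>{1..k}\<close> in \<open>trans_prob\<close> may be
  replaced by any set of size \<open>k\<close>. This is what makes the range size a Markov
  chain.\<close>

lemma card_self_maps_card_image:
  assumes "A \<subseteq> {1..n}"
  shows "real (card {h \<in> self_maps n. card (h ` A) = j}) = n ^ n * trans_prob n (card A) j"
proof -
  have "card A \<le> card {1..n}" using assms by (intro card_mono) auto
  then have sub: "{1..card A} \<subseteq> {1..n}" by auto
  have "card {h \<in> self_maps n. card (h ` A) = j} = card {h \<in> self_maps n. card (h ` {1..card A}) = j}"
    using assms sub by (intro antisym card_PiE_card_image_le) auto
  then show ?thesis by (cases "n = 0") (simp_all add: trans_prob_def)
qed

text \<open>The image of \<open>{1..k}\<close> keeps size \<open>k\<close> exactly when the map is
  injective there, which leaves a falling factorial over \<open>n ^ k\<close>.\<close>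

lemma trans_prob_self_eq_lam:
  assumes "k \<le> n"
  shows "trans_prob n k k = lam n k"
proof (cases "k = 0")
  case True
  then show ?thesis by (cases "n = 0") (simp_all add: trans_prob_def lam_def)
next
  case False
  then have n: "n > 0" using assms by simp
  have "{h \<in> self_maps n. card (h ` {1..k}) = k} = {h \<in> self_maps n. inj_on h {1..k}}"
    using inj_on_iff_eq_card[of "{1..k}"] by auto
  then have "trans_prob n k k = (\<Prod>j<k. real (n - j)) * n ^ (n - k) / n ^ n"
    using assms by (simp add: trans_prob_def card_PiE_inj_on_subset)
  also have "real (n ^ n) = real n ^ k * n ^ (n - k)"
    using assms by (simp flip: power_add)
  also have "(\<Prod>j<k. real (n - j)) * n ^ (n - k) / \<dots> = (\<Prod>j<k. real (n - j) / n)"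
    using n by (simp add: prod_dividef)
  also have "\<dots> = (\<Prod>j<k. 1 - real j / n)"
    using assms n by (intro prod.cong) (auto simp: of_nat_diff field_simps)
  \<comment> \<open>The factor at \<open>j = 0\<close> equals 1, and \<open>lam\<close> starts at
    \<open>j = 1\<close>.\<close>
  also have "\<dots> = lam n k"
    unfolding lam_def using False
    by (intro prod.mono_neutral_right) (auto simp: not_less_eq_eq)
  finally show ?thesis .
qed

lemma lam_nonneg: "k \<le> n \<Longrightarrow> 0 \<le> lam n k"
  unfolding lam_def by (intro prod_nonneg) (auto simp: field_simps)

text \<open>The factor at \<open>j = 1\<close> is already below 1, and the remaining factors are at
  most 1.\<close>

lemma lam_less_1:
  assumes "2 \<le> k" "k \<le> n"
  shows "lam n k < 1"
proof -
  have "lam n k = (1 - 1 / n) * (\<Prod>j = 2..<k. 1 - real j / real n)"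
    unfolding lam_def using assms
    by (subst prod.atLeast_Suc_lessThan) (auto simp: numeral_2_eq_2)
  also have "\<dots> \<le> (1 - 1 / n) * 1"
    using assms by (intro mult_left_mono prod_le_1) (auto simp: field_simps)
  also have "\<dots> < 1" using assms by simp
  finally show ?thesis .
qed

section \<open>Weights and the first-step equations\<close>

definition visit_weight :: "nat \<Rightarrow> complex \<Rightarrow> nat \<Rightarrow> complex"
  where "visit_weight K z j = (if 2 \<le> j \<and> j \<le> K then z else 1)"

definition step_weight :: "nat \<Rightarrow> complex \<Rightarrow> nat \<Rightarrow> nat \<Rightarrow> complex"
  where "step_weight K z k j =
    (if \<exists>m\<in>{1..K}. j < m \<and> m < k then 0 else visit_weight K z j)"

text \<open>
  The first-step equation at \<open>k\<close>, solved for its value at \<open>k\<close>: the denominator accounts for the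
  steps that stay at \<open>k\<close>.
\<close>

function path_gf :: "nat \<Rightarrow> nat \<Rightarrow> complex \<Rightarrow> nat \<Rightarrow> complex" where
  "path_gf n K z k = (if k \<le> 1 then 1 else
    (\<Sum>j = 1..<k. trans_prob n k j * step_weight K z k j * path_gf n K z j) /
    (1 - lam n k * visit_weight K z k))"
  by auto
termination by (relation "Wellfounded.measure (\<lambda>(n, K, z, k). k)") auto

declare path_gf.simps [simp del]

lemma norm_visit_weight: "norm z = 1 \<Longrightarrow> norm (visit_weight K z k) = 1"
  by (simp add: visit_weight_def)

lemma norm_step_weight_le: "norm z = 1 \<Longrightarrow> norm (step_weight K z k j) \<le> 1"
  by (simp add: step_weight_def norm_visit_weight)

lemma step_weight_self [simp]: "step_weight K z k k = visit_weight K z k"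
  by (auto simp: step_weight_def)

text \<open>The subtracted product has norm \<open>lam n k\<close>, which is below 1. Hence no
  denominator in \<open>path_gf\<close> vanishes for \<open>z\<close> on the unit circle.\<close>

lemma one_minus_lam_mult_nonzero:
  assumes "2 \<le> k" "k \<le> n" "norm w = 1"
  shows "1 - complex_of_real (lam n k) * w \<noteq> 0"
proof
  assume "1 - complex_of_real (lam n k) * w = 0"
  then have "norm (complex_of_real (lam n k) * w) = 1" by (metis norm_one right_minus_eq)
  then have "lam n k = 1" using lam_nonneg[of k n] assms by (simp add: norm_mult)
  then show False using lam_less_1[of k n] assms by simp
qed

lemma path_gf_harmonic:
  assumes "1 \<le> k" "k \<le> n" "norm z = 1"
  shows "(\<Sum>j = 1..k. trans_prob n k j * step_weight K z k j * path_gf n K z j) = path_gf n K z k"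
\<comment> \<open>At \<open>k = 1\<close> both \<open>lam\<close> and the weight are 1, so the
  solved form would divide by 0. There \<open>path_gf\<close> is set to 1 and the equation is
  checked directly.\<close>
proof (cases "k = 1")
  case True
  then show ?thesis
    using assms by (simp add: trans_prob_self_eq_lam visit_weight_def lam_def path_gf.simps)
next
  case False
  then have k: "2 \<le> k" using assms by simp
  have nz: "1 - complex_of_real (lam n k) * visit_weight K z k \<noteq> 0"
    using assms k by (intro one_minus_lam_mult_nonzero norm_visit_weight) auto
  let ?S = "\<Sum>j = 1..<k. trans_prob n k j * step_weight K z k j * path_gf n K z j"
  have "{1..k} = insert k {1..<k}" using k by auto
  then have "(\<Sum>j = 1..k. trans_prob n k j * step_weight K z k j * path_gf n K z j) =
      lam n k * visit_weight K z k * path_gf n K z k + ?S"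
    using assms by (simp add: trans_prob_self_eq_lam)
  moreover have "path_gf n K z k * (1 - lam n k * visit_weight K z k) = ?S"
    using k nz by (subst path_gf.simps) (simp del: One_nat_def)
  ultimately show ?thesis by (simp add: algebra_simps)
qed

text \<open>One step of the martingale, multiplied by the number of maps: grouping the maps by the
  size of the image of \<open>A\<close> turns the sum into the first-step equation at
  \<open>card A\<close>.\<close>

lemma sum_self_maps_path_gf:
  assumes "A \<subseteq> {1..n}" "A \<noteq> {}" "norm z = 1"
  shows "(\<Sum>h\<in>self_maps n. step_weight K z (card A) (card (h ` A)) * path_gf n K z (card (h ` A))) =
    n ^ n * path_gf n K z (card A)"
proof -
  let ?k = "card A"
  let ?F = "\<lambda>j. step_weight K z ?k j * path_gf n K z j"
  have finA: "finite A" using assms finite_subset by blast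
  have k: "1 \<le> ?k" "?k \<le> n"
    using finA assms card_mono[of "{1..n}" A] by (auto simp: Suc_le_eq card_gt_0_iff)
  have "(\<Sum>h\<in>self_maps n. ?F (card (h ` A))) =
      (\<Sum>j = 1..?k. \<Sum>h\<in>{h \<in> self_maps n. card (h ` A) = j}. ?F (card (h ` A)))"
    using finA assms
    by (intro sum.group[symmetric]) (auto simp: card_image_le Suc_le_eq card_gt_0_iff)
  also have "\<dots> = (\<Sum>j = 1..?k. of_real (card {h \<in> self_maps n. card (h ` A) = j}) * ?F j)"
    by (intro sum.cong) auto
  also have "\<dots> = (\<Sum>j = 1..?k. n ^ n * (trans_prob n ?k j * step_weight K z ?k j * path_gf n K z j))"
    using assms(1) by (intro sum.cong) (auto simp only: card_self_maps_card_image, simp)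
  also have "\<dots> = n ^ n * path_gf n K z ?k"
    using path_gf_harmonic[OF k assms(3)] by (simp flip: sum_distrib_left)
  finally show ?thesis by simp
qed

text \<open>The point is that \<open>c\<close> is chosen before \<open>z\<close>. A trajectory of
  nonzero weight that starts above \<open>K\<close> cannot jump over \<open>K\<close>, and until it
  lands there all its weights are 1.\<close>

lemma path_gf_above_threshold:
  assumes "1 \<le> K" "K < k" "k \<le> n"
  shows "\<exists>c. \<forall>z. path_gf n K z k = c * (visit_weight K z K * path_gf n K z K)"
  using assms(2,3)
proof (induction k rule: less_induct)
  case (less k)
  have "\<forall>j\<in>{K<..<k}. \<exists>c. \<forall>z. path_gf n K z j = c * (visit_weight K z K * path_gf n K z K)"
    using less by auto
  then obtain c where c: "\<And>j z. j \<in> {K<..<k} \<Longrightarrow>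
      path_gf n K z j = c j * (visit_weight K z K * path_gf n K z K)"
    by metis
  \<comment> \<open>The coefficient after a first step to \<open>j\<close>: 0 if the step skips
    \<open>K\<close>, 1 if it lands on \<open>K\<close>, and the inductive constant if it stays
    above \<open>K\<close>.\<close>
  define b where "b j = (if j < K then 0 else if j = K then 1 else c j)" for j
  have "step_weight K z k j * path_gf n K z j = b j * (visit_weight K z K * path_gf n K z K)"
    if j: "1 \<le> j" "j < k" for z j
  proof -
    consider "j < K" | "j = K" | "K < j" by linarith
    then show ?thesis
    proof cases
      case 1
      then show ?thesis using j less.prems assms(1) by (auto simp: step_weight_def b_def)
    next
      case 2
      then show ?thesis by (auto simp: step_weight_def b_def)
    next
      case 3
      then show ?thesis using c[of j z] j by (auto simp: step_weight_def visit_weight_def b_def)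
    qed
  qed
  then have "(\<Sum>j = 1..<k. trans_prob n k j * step_weight K z k j * path_gf n K z j) =
      (\<Sum>j = 1..<k. trans_prob n k j * b j) * (visit_weight K z K * path_gf n K z K)" for z
    by (subst sum_distrib_right) (intro sum.cong, auto simp: mult.assoc)
  then have "path_gf n K z k = (\<Sum>j = 1..<k. trans_prob n k j * b j) / (1 - lam n k) *
      (visit_weight K z K * path_gf n K z K)" for z
    using less.prems assms(1) by (subst path_gf.simps) (simp add: visit_weight_def)
  then show ?case by blast
qed

text \<open>From level \<open>k + 1\<close> only staying or moving to \<open>k\<close> has nonzero
  weight, so the recursion has a single term. The factor \<open>visit_weight K z k\<close> pays for
  arriving at \<open>k\<close>; arriving at 1 costs nothing, whence the exponent
  \<open>k - 1\<close>.\<close>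

lemma path_gf_below_threshold:
  fixes z :: complex
  assumes "1 \<le> k" "k \<le> K"
  shows "visit_weight K z k * path_gf n K z k =
    z ^ (k - 1) * (\<Prod>m = 2..k. trans_prob n m (m - 1) / (1 - lam n m * z))"
  using assms
proof (induction k rule: dec_induct)
  case base
  then show ?case by (simp add: visit_weight_def path_gf.simps)
next
  case (step k)
  have "(\<Sum>j = 1..<Suc k. trans_prob n (Suc k) j * step_weight K z (Suc k) j * path_gf n K z j) =
      (\<Sum>j\<in>{k}. trans_prob n (Suc k) j * step_weight K z (Suc k) j * path_gf n K z j)"
  proof (rule sum.mono_neutral_right)
    show "\<forall>j\<in>{1..<Suc k} - {k}.
        trans_prob n (Suc k) j * step_weight K z (Suc k) j * path_gf n K z j = 0"
    proof
      fix j assume "j \<in> {1..<Suc k} - {k}"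
      then have "j < k" "k \<in> {1..K}" using step by auto
      then have "step_weight K z (Suc k) j = 0" unfolding step_weight_def by auto
      then show "trans_prob n (Suc k) j * step_weight K z (Suc k) j * path_gf n K z j = 0" by simp
    qed
  qed (use step in auto)
  also have "\<dots> = trans_prob n (Suc k) k * (visit_weight K z k * path_gf n K z k)"
    by (auto simp: step_weight_def)
  finally have "path_gf n K z (Suc k) =
      trans_prob n (Suc k) k * (visit_weight K z k * path_gf n K z k) / (1 - lam n (Suc k) * z)"
    using step by (subst path_gf.simps) (simp add: visit_weight_def)
  moreover have "{2..Suc k} = insert (Suc k) {2..k}" using step by auto
  moreover have "z * z ^ (k - 1) = z ^ k" using step by (cases k) auto
  ultimately show ?case using step by (simp add: visit_weight_def[of _ _ "Suc k"])
qed

section \<open>Range sizes along a trajectory\<close>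

lemma g_image_0 [simp]: "g n \<phi> 0 ` {Suc 0..n} = {Suc 0..n}"
  by simp

text \<open>Since \<open>g\<close> at time 0 is the identity on \<open>{1..n}\<close>, the recursion
  for images holds from \<open>s = 0\<close> on, and the chain can be started at time 0 in state
  \<open>n\<close>.\<close>

lemma g_image_Suc: "g n \<phi> (Suc s) ` {1..n} = \<phi> (Suc s) ` g n \<phi> s ` {1..n}"
  by (cases s) (auto simp: compose_def image_image)

lemma g_cong: "(\<And>s. 1 \<le> s \<Longrightarrow> s \<le> t \<Longrightarrow> \<phi> s = \<psi> s) \<Longrightarrow> g n \<phi> t = g n \<psi> t"
  by (induction n \<phi> t rule: g.induct) auto

definition range_size :: "nat \<Rightarrow> (nat \<Rightarrow> nat \<Rightarrow> nat) \<Rightarrow> nat \<Rightarrow> nat"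
  where "range_size n \<phi> t = card (g n \<phi> t ` {1..n})"

lemma range_size_0 [simp]: "range_size n \<phi> 0 = n"
  unfolding range_size_def by simp

text \<open>Together with \<open>path_weight_cong\<close> this allows an infinite sequence to be
  replaced by its first \<open>t\<close> maps, and shows that changing the map at
  \<open>t + 1\<close> leaves the past untouched.\<close>

lemma range_size_cong:
  "(\<And>s. 1 \<le> s \<Longrightarrow> s \<le> t \<Longrightarrow> \<phi> s = \<psi> s) \<Longrightarrow> range_size n \<phi> t = range_size n \<psi> t"
  unfolding range_size_def by (subst g_cong[of t \<phi> \<psi>]) auto

lemma range_size_antimono: "antimono (range_size n \<phi>)"
  unfolding decseq_Suc_iff range_size_def g_image_Suc by (intro allI card_image_le) auto

lemma range_size_pos: "n > 0 \<Longrightarrow> range_size n \<phi> s > 0"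
  unfolding range_size_def by (auto simp: card_gt_0_iff)

lemma g_image_subset:
  assumes "\<And>s. 1 \<le> s \<Longrightarrow> s \<le> t \<Longrightarrow> \<phi> s \<in> self_maps n"
  shows "g n \<phi> t ` {1..n} \<subseteq> {1..n}"
  using assms
proof (induction t)
  case (Suc t)
  have "\<phi> (Suc t) \<in> self_maps n" using Suc.prems by simp
  moreover have "g n \<phi> t ` {1..n} \<subseteq> {1..n}" using Suc by simp
  ultimately show ?case unfolding g_image_Suc by (auto simp: PiE_iff image_subset_iff)
qed simp

section \<open>The martingale identity\<close>

definition path_weight :: "nat \<Rightarrow> nat \<Rightarrow> complex \<Rightarrow> (nat \<Rightarrow> nat \<Rightarrow> nat) \<Rightarrow> nat \<Rightarrow> complex"
  where "path_weight n K z \<phi> t =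
    (\<Prod>s<t. step_weight K z (range_size n \<phi> s) (range_size n \<phi> (Suc s)))"

lemma path_weight_cong:
  assumes "\<And>s. 1 \<le> s \<Longrightarrow> s \<le> t \<Longrightarrow> \<phi> s = \<psi> s"
  shows "path_weight n K z \<phi> t = path_weight n K z \<psi> t"
  unfolding path_weight_def
proof (rule prod.cong[OF refl])
  fix s assume "s \<in> {..<t}"
  then have "range_size n \<phi> s = range_size n \<psi> s" "range_size n \<phi> (Suc s) = range_size n \<psi> (Suc s)"
    using assms by (auto intro!: range_size_cong)
  then show "step_weight K z (range_size n \<phi> s) (range_size n \<phi> (Suc s)) =
    step_weight K z (range_size n \<psi> s) (range_size n \<psi> (Suc s))" by simp
qed

lemma norm_path_weight_le: "norm z = 1 \<Longrightarrow> norm (path_weight n K z \<phi> t) \<le> 1"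
  unfolding path_weight_def prod_norm[symmetric]
  by (intro prod_le_1) (auto intro: norm_step_weight_le)

text \<open>Divided by the number of tuples, this says that the martingale has constant expectation.
  The induction peels off the last map: it affects only the last factor of the weight, and the sum
  over it is the one-step identity for the range \<open>?A\<close> reached so far.\<close>

lemma sum_path_weight_mult_path_gf:
  assumes "n > 0" "norm z = 1"
  shows "(\<Sum>a\<in>{1..t} \<rightarrow>\<^sub>E self_maps n. path_weight n K z a t * path_gf n K z (range_size n a t)) =
    of_nat (n ^ n) ^ t * path_gf n K z n"
proof (induction t)
  case 0
  then show ?case by (simp add: path_weight_def)
next
  case (Suc t)
  have ins: "{1..Suc t} = insert (Suc t) {1..t}" by auto
  have "(\<Sum>h\<in>self_maps n. path_weight n K z (a(Suc t := h)) (Suc t) *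
        path_gf n K z (range_size n (a(Suc t := h)) (Suc t))) =
      n ^ n * (path_weight n K z a t * path_gf n K z (range_size n a t))"
    if a: "a \<in> {1..t} \<rightarrow>\<^sub>E self_maps n" for a
  proof -
    let ?A = "g n a t ` {1..n}"
    have "range_size n (a(Suc t := h)) (Suc t) = card (h ` ?A)" for h
    proof -
      have "g n (a(Suc t := h)) t = g n a t" by (rule g_cong) auto
      then show ?thesis unfolding range_size_def g_image_Suc by simp
    qed
    moreover have "path_weight n K z (a(Suc t := h)) (Suc t) =
        path_weight n K z a t * step_weight K z (card ?A) (card (h ` ?A))" for h
    proof -
      have "path_weight n K z (a(Suc t := h)) t = path_weight n K z a t"
        "range_size n (a(Suc t := h)) t = card ?A"
        by (rule path_weight_cong, simp) (subst range_size_def[symmetric], rule range_size_cong, simp)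
      then show ?thesis
        using calculation by (simp add: path_weight_def)
    qed
    moreover have "?A \<subseteq> {1..n}" using a by (intro g_image_subset) (auto simp: PiE_iff)
    moreover have "?A \<noteq> {}" using assms by auto
    ultimately show ?thesis
      using sum_self_maps_path_gf[of ?A n z K] assms
      by (simp add: mult.assoc range_size_def flip: sum_distrib_left)
  qed
  then show ?case unfolding ins
    by (subst sum_PiE_insert) (simp_all add: Suc[simplified] mult.assoc flip: sum_distrib_left)
qed

section \<open>Visit counts read off from the path weight\<close>

lemma tau_eq_card:
  assumes "range_size n \<phi> N = 1" "m \<ge> 2"
  shows "\<tau> n \<phi> m = of_nat (card {s \<in> {1..N}. range_size n \<phi> s = m})"
proof -
  \<comment> \<open>Once the range is a singleton no size \<open>m >= 2\<close> recurs, so all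
    visits to \<open>m\<close> happen before time \<open>N\<close> and the count is finite.\<close>
  have "s \<le> N" if "range_size n \<phi> s = m" for s
  proof (rule ccontr)
    assume "\<not> s \<le> N"
    then have "range_size n \<phi> s \<le> range_size n \<phi> N"
      using antimonoD[OF range_size_antimono, of N s n \<phi>] by simp
    then show False using assms that by simp
  qed
  then have "{t. 1 \<le> t \<and> card (g n \<phi> t ` {1..n}) = m} = {s \<in> {1..N}. range_size n \<phi> s = m}"
    by (auto simp: range_size_def)
  then show ?thesis unfolding \<tau>_def by (simp add: emeasure_count_space_finite)
qed

lemma tau_pos_iff: "\<tau> n \<phi> m > 0 \<longleftrightarrow> (\<exists>s\<ge>1. range_size n \<phi> s = m)"
proof -
  have "\<tau> n \<phi> m = 0 \<longleftrightarrow> {t. 1 \<le> t \<and> card (g n \<phi> t ` {1..n}) = m} = {}"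
    unfolding \<tau>_def by (simp add: emeasure_count_space_eq_0)
  then show ?thesis by (auto simp: range_size_def zero_less_iff_neq_zero)
qed

lemma prod_visit_weight:
  "(\<Prod>s\<in>{1..N}. visit_weight K z (range_size n \<phi> s)) =
    z ^ card {s \<in> {1..N}. range_size n \<phi> s \<in> {2..K}}"
proof -
  have "(\<Prod>s\<in>{1..N}. visit_weight K z (range_size n \<phi> s)) =
      (\<Prod>s\<in>{s \<in> {1..N}. range_size n \<phi> s \<in> {2..K}}. z)"
    by (rule prod.mono_neutral_cong_right) (auto simp: visit_weight_def)
  then show ?thesis by simp
qed

lemma sum_tau_eq_card:
  assumes "range_size n \<phi> N = 1"
  shows "(\<Sum>m = 2..K. \<tau> n \<phi> m) = of_nat (card {s \<in> {1..N}. range_size n \<phi> s \<in> {2..K}})"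
proof -
  have "(\<Sum>m = 2..K. \<tau> n \<phi> m) = of_nat (\<Sum>m = 2..K. card {s \<in> {1..N}. range_size n \<phi> s = m})"
    using assms by (simp add: tau_eq_card)
  also have "(\<Sum>m = 2..K. card {s \<in> {1..N}. range_size n \<phi> s = m}) =
      card (\<Union>m\<in>{2..K}. {s \<in> {1..N}. range_size n \<phi> s = m})"
    by (rule card_UN_disjoint[symmetric]) auto
  also have "(\<Union>m\<in>{2..K}. {s \<in> {1..N}. range_size n \<phi> s = m}) =
      {s \<in> {1..N}. range_size n \<phi> s \<in> {2..K}}" by auto
  finally show ?thesis .
qed

lemma visits_all_iff_no_skip:
  assumes "range_size n \<phi> N = 1" "K < n"
  shows "(\<forall>m\<in>{1..K}. \<tau> n \<phi> m > 0) \<longleftrightarrow>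
    (\<forall>s<N. \<not> (\<exists>m\<in>{1..K}. range_size n \<phi> (Suc s) < m \<and> m < range_size n \<phi> s))"
  (is "?L \<longleftrightarrow> ?R")
proof
  assume L: ?L
  show ?R
  proof (intro allI impI notI)
    fix s assume "\<exists>m\<in>{1..K}. range_size n \<phi> (Suc s) < m \<and> m < range_size n \<phi> s"
    then obtain m where m: "m \<in> {1..K}" "range_size n \<phi> (Suc s) < m" "m < range_size n \<phi> s" by blast
    then obtain r where r: "range_size n \<phi> r = m" using L tau_pos_iff by blast
    show False
    proof (cases "r \<le> s")
      case True
      then show False using antimonoD[OF range_size_antimono True, of n \<phi>] m r by simp
    next
      case False
      then show False using antimonoD[OF range_size_antimono, of "Suc s" r n \<phi>] m r by simp
    qed
  qed
next
  assume R: ?R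
  show ?L
  proof
    fix m assume m: "m \<in> {1..K}"
    \<comment> \<open>The candidate visit is the first time at or below \<open>m\<close>. The state
      just before it exceeds \<open>m\<close>, so a step that skips nothing must land on
      \<open>m\<close>.\<close>
    define r where "r = (LEAST s. range_size n \<phi> s \<le> m)"
    have N: "range_size n \<phi> N \<le> m" using assms m by simp
    have r: "range_size n \<phi> r \<le> m" unfolding r_def using N by (rule LeastI)
    have "r \<le> N" unfolding r_def using N by (rule Least_le)
    \<comment> \<open>As \<open>K < n\<close>, the chain starts above \<open>m\<close>. The visit
      therefore occurs at a time at least 1, as \<open>\<tau>\<close> requires.\<close>
    have "r \<noteq> 0" using r m assms by (intro notI) auto
    then obtain q where q: "r = Suc q" using not0_implies_Suc by blast
    have "range_size n \<phi> q > m" using not_less_Least[of q "\<lambda>s. range_size n \<phi> s \<le> m"] q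
      unfolding r_def by auto
    then have "\<not> range_size n \<phi> r < m" using R m q \<open>r \<le> N\<close> by (auto simp: Suc_le_eq)
    then have "range_size n \<phi> r = m" using r by simp
    then show "\<tau> n \<phi> m > 0" using q unfolding tau_pos_iff by auto
  qed
qed

lemma path_weight_eq_power:
  assumes "range_size n \<phi> N = 1" "K < n"
  shows "path_weight n K z \<phi> N =
    of_bool (\<forall>m\<in>{1..K}. \<tau> n \<phi> m > 0) * z ^ card {s \<in> {1..N}. range_size n \<phi> s \<in> {2..K}}"
proof (cases "\<forall>m\<in>{1..K}. \<tau> n \<phi> m > 0")
  case True
  have "path_weight n K z \<phi> N = (\<Prod>s<N. visit_weight K z (range_size n \<phi> (Suc s)))"
    unfolding path_weight_def
  proof (rule prod.cong[OF refl])
    fix s assume "s \<in> {..<N}"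
    then have "\<not> (\<exists>m\<in>{1..K}. range_size n \<phi> (Suc s) < m \<and> m < range_size n \<phi> s)"
      using True unfolding visits_all_iff_no_skip[OF assms] by blast
    then show "step_weight K z (range_size n \<phi> s) (range_size n \<phi> (Suc s)) =
        visit_weight K z (range_size n \<phi> (Suc s))"
      unfolding step_weight_def by (simp only: if_False)
  qed
  also have "\<dots> = (\<Prod>s\<in>{1..N}. visit_weight K z (range_size n \<phi> s))"
    by (rule prod.reindex_bij_witness[of _ "\<lambda>s. s - 1" Suc]) auto
  finally show ?thesis using True prod_visit_weight by (simp del: One_nat_def)
next
  case False
  then obtain s where "s < N" "\<exists>m\<in>{1..K}. range_size n \<phi> (Suc s) < m \<and> m < range_size n \<phi> s"
    unfolding visits_all_iff_no_skip[OF assms] by blast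
  then have "path_weight n K z \<phi> N = 0"
    unfolding path_weight_def by (intro prod_zero) (auto simp: step_weight_def)
  then show ?thesis using False by simp
qed

section \<open>Independent uniform random maps\<close>

locale random_self_maps = prob_space M for M :: "'a measure" +
  fixes n :: nat and f :: "nat \<Rightarrow> 'a \<Rightarrow> nat \<Rightarrow> nat"
  assumes n_pos: "n > 0"
    and indep: "indep_vars (\<lambda>_. count_space (self_maps n)) f {1..}"
    and uniform: "\<And>s. s \<ge> 1 \<Longrightarrow>
      distr M (count_space (self_maps n)) (f s) = uniform_count_measure (self_maps n)"
begin

text \<open>A finite prefix takes only finitely many values on the sample space, so functions of it
  are measurable and their expectations are finite sums.\<close>

definition initial_maps :: "nat \<Rightarrow> 'a \<Rightarrow> nat \<Rightarrow> nat \<Rightarrow> nat"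
  where "initial_maps t \<omega> = (\<lambda>s\<in>{1..t}. f s \<omega>)"

lemma measurable_maps: "s \<ge> 1 \<Longrightarrow> f s \<in> M \<rightarrow>\<^sub>M count_space (self_maps n)"
  using indep by (auto simp: indep_vars_def)

lemma maps_in_self_maps: "s \<ge> 1 \<Longrightarrow> \<omega> \<in> space M \<Longrightarrow> f s \<omega> \<in> self_maps n"
  using measurable_space[OF measurable_maps] by simp

lemma prob_map_in:
  assumes "s \<ge> 1" "B \<subseteq> self_maps n"
  shows "prob (f s -` B \<inter> space M) = card B / n ^ n"
proof -
  have "prob (f s -` B \<inter> space M) = measure (distr M (count_space (self_maps n)) (f s)) B"
    using assms by (subst measure_distr[OF measurable_maps]) auto
  also have "\<dots> = card B / n ^ n"
    unfolding uniform[OF assms(1)] using assms(2) by (simp add: measure_uniform_count_measure)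
  finally show ?thesis .
qed

lemma prob_maps_in:
  assumes "\<And>s. s \<in> {1..t} \<Longrightarrow> B s \<subseteq> self_maps n"
  shows "prob {\<omega> \<in> space M. \<forall>s\<in>{1..t}. f s \<omega> \<in> B s} = (\<Prod>s\<in>{1..t}. card (B s) / n ^ n)"
\<comment> \<open>The empty index set is treated apart: an empty intersection would be the whole
  type instead of the sample space.\<close>
proof (cases "t = 0")
  case True
  then show ?thesis by (simp add: prob_space)
next
  case False
  then have "{\<omega> \<in> space M. \<forall>s\<in>{1..t}. f s \<omega> \<in> B s} = (\<Inter>s\<in>{1..t}. f s -` B s \<inter> space M)"
    by auto
  also have "prob \<dots> = (\<Prod>s\<in>{1..t}. prob (f s -` B s \<inter> space M))"
    using False assms by (intro indep_varsD[OF indep]) auto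
  also have "\<dots> = (\<Prod>s\<in>{1..t}. card (B s) / n ^ n)"
    using assms by (intro prod.cong prob_map_in) auto
  finally show ?thesis .
qed

lemma initial_maps_eq_iff:
  assumes "a \<in> {1..t} \<rightarrow>\<^sub>E self_maps n"
  shows "initial_maps t \<omega> = a \<longleftrightarrow> (\<forall>s\<in>{1..t}. f s \<omega> \<in> {a s})"
  using assms by (auto simp: initial_maps_def fun_eq_iff PiE_iff extensional_def)

lemma measurable_initial_maps:
  "initial_maps t \<in> M \<rightarrow>\<^sub>M count_space ({1..t} \<rightarrow>\<^sub>E self_maps n)"
proof (subst measurable_count_space_eq2, goal_cases)
  case 1
  show ?case by (intro finite_PiE) auto
next
  case 2
  have "initial_maps t \<omega> \<in> {1..t} \<rightarrow>\<^sub>E self_maps n" if "\<omega> \<in> space M" for \<omega>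
    unfolding initial_maps_def using maps_in_self_maps that by auto
  moreover have "initial_maps t -` {a} \<inter> space M \<in> events"
    if a: "a \<in> {1..t} \<rightarrow>\<^sub>E self_maps n" for a
  proof -
    have "initial_maps t -` {a} \<inter> space M =
        space M \<inter> (\<Inter>s\<in>{1..t}. f s -` {a s} \<inter> space M)" if "t \<noteq> 0"
      using initial_maps_eq_iff[OF a] that by auto
    moreover have "(\<Inter>s\<in>{1..t}. f s -` {a s} \<inter> space M) \<in> events" if "t \<noteq> 0"
      using that a by (intro sets.finite_INT measurable_sets[OF measurable_maps]) auto
    moreover have "initial_maps t -` {a} \<inter> space M = space M" if "t = 0"
      using initial_maps_eq_iff[OF a] that by auto
    ultimately show "initial_maps t -` {a} \<inter> space M \<in> events"
      by (cases "t = 0") (simp_all only: if_True not_False_eq_True sets.Int sets.top simp_thms)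
  qed
  ultimately show ?case by blast
qed

text \<open>Independence and uniformity make all tuples of \<open>t\<close> maps equally likely.
  This turns the counting identities into statements about expectations.\<close>

lemma expectation_initial_maps:
  fixes G :: "(nat \<Rightarrow> nat \<Rightarrow> nat) \<Rightarrow> complex"
  shows "(\<integral>\<omega>. G (initial_maps t \<omega>) \<partial>M) = (\<Sum>a\<in>{1..t} \<rightarrow>\<^sub>E self_maps n. G a) / of_nat (n ^ n) ^ t"
proof -
  let ?S = "{1..t} \<rightarrow>\<^sub>E self_maps n"
  let ?E = "\<lambda>a. {\<omega> \<in> space M. initial_maps t \<omega> = a}"
  have finS: "finite ?S" by (intro finite_PiE) auto
  have ev: "?E a \<in> events" if "a \<in> ?S" for a
    using measurable_sets[OF measurable_initial_maps, of "{a}" t] that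
    by (auto simp: vimage_def Int_def conj_commute)
  have prob: "prob (?E a) = 1 / (n ^ n) ^ t" if "a \<in> ?S" for a
    using prob_maps_in[of t "\<lambda>s. {a s}"] that
    by (simp add: initial_maps_eq_iff[OF that] PiE_iff power_one_over)
  have "(\<integral>\<omega>. G (initial_maps t \<omega>) \<partial>M) = (\<integral>\<omega>. (\<Sum>a\<in>?S. indicator (?E a) \<omega> *\<^sub>R G a) \<partial>M)"
  proof (rule Bochner_Integration.integral_cong[OF refl])
    fix \<omega> assume w: "\<omega> \<in> space M"
    have "(\<Sum>a\<in>?S. indicator (?E a) \<omega> *\<^sub>R G a) = (\<Sum>a\<in>?S. if initial_maps t \<omega> = a then G a else 0)"
      using w by (intro sum.cong) auto
    also have "\<dots> = G (initial_maps t \<omega>)"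
      using measurable_space[OF measurable_initial_maps w, of t] finS by (simp add: sum.delta)
    finally show "G (initial_maps t \<omega>) = (\<Sum>a\<in>?S. indicator (?E a) \<omega> *\<^sub>R G a)" ..
  qed
  also have "\<dots> = (\<Sum>a\<in>?S. \<integral>\<omega>. indicator (?E a) \<omega> *\<^sub>R G a \<partial>M)"
    using ev by (intro Bochner_Integration.integral_sum) (auto simp: less_top[symmetric])
  also have "\<dots> = (\<Sum>a\<in>?S. prob (?E a) *\<^sub>R G a)"
    using ev by (intro sum.cong) (auto simp: less_top[symmetric])
  also have "\<dots> = (\<Sum>a\<in>?S. G a) / of_nat (n ^ n) ^ t"
    using prob by (simp add: scaleR_conv_of_real sum_divide_distrib)
  finally show ?thesis .
qed

lemma range_size_initial_maps:
  "s \<le> t \<Longrightarrow> range_size n (initial_maps t \<omega>) s = range_size n (\<lambda>s. f s \<omega>) s"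
  by (rule range_size_cong) (auto simp: initial_maps_def)

lemma path_weight_initial_maps:
  "path_weight n K z (initial_maps t \<omega>) t = path_weight n K z (\<lambda>s. f s \<omega>) t"
  by (rule path_weight_cong) (auto simp: initial_maps_def)

lemma measurable_range_size [measurable]:
  "(\<lambda>\<omega>. range_size n (\<lambda>s. f s \<omega>) t) \<in> M \<rightarrow>\<^sub>M count_space UNIV"
proof -
  have "(\<lambda>\<omega>. range_size n (initial_maps t \<omega>) t) \<in> M \<rightarrow>\<^sub>M count_space UNIV"
    using measurable_initial_maps by (rule measurable_compose) simp
  then show ?thesis by (simp add: range_size_initial_maps)
qed

text \<open>The counting measure is written as a series of indicators over all times, which also
  covers the value infinity.\<close>

lemma measurable_tau [measurable]: "(\<lambda>\<omega>. \<tau> n (\<lambda>s. f s \<omega>) m) \<in> borel_measurable M"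
proof -
  have "\<tau> n (\<lambda>s. f s \<omega>) m = (\<Sum>t. if 1 \<le> t \<and> range_size n (\<lambda>s. f s \<omega>) t = m then 1 else 0)" for \<omega>
    unfolding \<tau>_def range_size_def
    by (subst nn_integral_count_space_nat[symmetric], subst nn_integral_indicator[symmetric])
      (simp, rule nn_integral_cong, auto simp: indicator_def)
  then show ?thesis by simp
qed

lemma AE_range_size_eventually_1: "AE \<omega> in M. \<exists>N. range_size n (\<lambda>s. f s \<omega>) N = 1"
proof -
  define C where "C = (\<lambda>c. \<lambda>x\<in>{1..n}. c) ` {1..n}"
  define D where "D = self_maps n - C"
  let ?B = "\<lambda>t. {\<omega> \<in> space M. \<forall>s\<in>{1..t}. f s \<omega> \<in> D}"
  \<comment> \<open>A single constant map collapses the range, and infinitely many independent trials miss the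
    constant maps with probability 0.\<close>
  define q where "q = real (card D) / n ^ n"
  have C: "C \<subseteq> self_maps n" "C \<noteq> {}" using n_pos by (auto simp: C_def)
  then have "card D < card (self_maps n)"
    by (intro psubset_card_mono) (simp, auto simp: D_def)
  then have "q < 1" "0 \<le> q" using n_pos by (simp_all add: q_def)
  have P: "prob (?B t) = q ^ t" for t
    using prob_maps_in[of t "\<lambda>_. D"] D_def by (simp add: q_def)
  have B: "?B t \<in> events" for t
  proof -
    have "?B t = initial_maps t -` ({1..t} \<rightarrow>\<^sub>E D) \<inter> space M"
      by (simp only: initial_maps_def vimage_def restrict_PiE_iff) blast
    also have "\<dots> \<in> events"
      by (rule measurable_sets[OF measurable_initial_maps]) (auto simp: PiE_iff D_def)
    finally show ?thesis .
  qed
  have INT: "(\<Inter>t. ?B t) \<in> events" using B by blast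
  have "prob (\<Inter>t. ?B t) \<le> q ^ t" for t
    unfolding P[symmetric] by (intro finite_measure_mono B INT_lower) simp
  moreover have "(\<lambda>t. q ^ t) \<longlonglongrightarrow> 0" using \<open>q < 1\<close> \<open>0 \<le> q\<close> by (intro LIMSEQ_realpow_zero) auto
  ultimately have "prob (\<Inter>t. ?B t) \<le> 0" by (meson LIMSEQ_le_const)
  then have "prob (\<Inter>t. ?B t) = 0" by (simp add: measure_le_0_iff)
  then have "AE \<omega> in M. \<omega> \<notin> (\<Inter>t. ?B t)"
    using INT prob_eq_0 by blast
  then show ?thesis
  proof (rule AE_mp, intro AE_I2 impI)
    fix \<omega> assume w: "\<omega> \<in> space M" and "\<omega> \<notin> (\<Inter>t. ?B t)"
    then obtain s where s: "1 \<le> s" "f s \<omega> \<notin> D"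
      by auto
    have "f s \<omega> \<in> C" using s maps_in_self_maps[OF s(1) w] by (simp add: D_def)
    then obtain c where "f s \<omega> = (\<lambda>x\<in>{1..n}. c)" unfolding C_def by (rule imageE)
    moreover obtain u where "s = Suc u" using s(1) by (cases s) simp_all
    ultimately have c: "f (Suc u) \<omega> = (\<lambda>x\<in>{1..n}. c)" by simp
    have "g n (\<lambda>s. f s \<omega>) u ` {1..n} \<subseteq> {1..n}"
      using w by (intro g_image_subset maps_in_self_maps) auto
    then have "f (Suc u) \<omega> ` g n (\<lambda>s. f s \<omega>) u ` {1..n} = {c}"
      using n_pos unfolding c by (force simp: image_subset_iff)
    then have "range_size n (\<lambda>s. f s \<omega>) (Suc u) = 1"
      unfolding range_size_def g_image_Suc by simp
    then show "\<exists>N. range_size n (\<lambda>s. f s \<omega>) N = 1" ..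
  qed
qed

lemma measurable_exp_sum_tau [measurable]:
  "(\<lambda>\<omega>. exp (\<i> * complex_of_real (t * enn2real (\<Sum>m = 2..K. \<tau> n (\<lambda>s. f s \<omega>) m)))) \<in> borel_measurable M"
  by measurable

text \<open>Passage from finite times to the limit: \<open>Y N\<close> has the same expectation for
  every \<open>N\<close>, is bounded, and almost surely becomes constant in
  \<open>N\<close>.\<close>

lemma expectation_exp_sum_tau:
  fixes t :: real
  assumes "K < n"
  shows "(\<integral>\<omega>. of_bool (\<forall>m\<in>{1..K}. \<tau> n (\<lambda>s. f s \<omega>) m > 0) *
      exp (\<i> * complex_of_real (t * enn2real (\<Sum>m = 2..K. \<tau> n (\<lambda>s. f s \<omega>) m))) \<partial>M) =
    path_gf n K (exp (\<i> * t)) n"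
proof -
  define z where "z = exp (\<i> * complex_of_real t)"
  have z: "norm z = 1" by (simp add: z_def)
  define X where "X \<omega> = of_bool (\<forall>m\<in>{1..K}. \<tau> n (\<lambda>s. f s \<omega>) m > 0) *
      exp (\<i> * complex_of_real (t * enn2real (\<Sum>m = 2..K. \<tau> n (\<lambda>s. f s \<omega>) m)))" for \<omega>
  define Y where "Y N \<omega> = path_weight n K z (\<lambda>s. f s \<omega>) N *
    path_gf n K z (range_size n (\<lambda>s. f s \<omega>) N)" for N \<omega>
  \<comment> \<open>Range sizes never exceed \<open>n\<close>, so this finite sum bounds every value
    of \<open>path_gf\<close> that occurs.\<close>
  define C where "C = (\<Sum>k\<le>n. norm (path_gf n K z k))"
  have Y: "Y N \<omega> = path_weight n K z (initial_maps N \<omega>) N *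
    path_gf n K z (range_size n (initial_maps N \<omega>) N)" for N \<omega>
    by (simp add: Y_def path_weight_initial_maps range_size_initial_maps)
  have "(\<lambda>N. \<integral>\<omega>. Y N \<omega> \<partial>M) \<longlonglongrightarrow> (\<integral>\<omega>. X \<omega> \<partial>M)"
  proof (rule integral_dominated_convergence[where w = "\<lambda>_. C"])
    show "X \<in> borel_measurable M" unfolding X_def by measurable
    show "Y N \<in> borel_measurable M" for N
      unfolding Y using measurable_initial_maps by (rule measurable_compose) simp
    show "integrable M (\<lambda>_. C)" by simp
    show "AE \<omega> in M. norm (Y N \<omega>) \<le> C" for N
    proof (rule AE_I2)
      fix \<omega>
      have "range_size n (\<lambda>s. f s \<omega>) N \<le> n"
        using antimonoD[OF range_size_antimono, of 0 N n "\<lambda>s. f s \<omega>"] by simp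
      then have "norm (path_gf n K z (range_size n (\<lambda>s. f s \<omega>) N)) \<le> C"
        unfolding C_def by (intro member_le_sum) auto
      then have "norm (Y N \<omega>) \<le> 1 * C"
        unfolding Y_def norm_mult using z by (intro mult_mono norm_path_weight_le) auto
      then show "norm (Y N \<omega>) \<le> C" by simp
    qed
    show "AE \<omega> in M. (\<lambda>N. Y N \<omega>) \<longlonglongrightarrow> X \<omega>"
      using AE_range_size_eventually_1
    proof (rule AE_mp, intro AE_I2 impI)
      fix \<omega> assume "\<exists>N. range_size n (\<lambda>s. f s \<omega>) N = 1"
      then obtain N where N: "range_size n (\<lambda>s. f s \<omega>) N = 1" by blast
      \<comment> \<open>After absorption \<open>path_gf\<close> contributes 1, and the path weight
        already equals its final power of \<open>z\<close>, or 0 if a level was missed.\<close>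
      have "Y r \<omega> = X \<omega>" if "N \<le> r" for r
      proof -
        have r: "range_size n (\<lambda>s. f s \<omega>) r = 1"
          using antimonoD[OF range_size_antimono that, of n "\<lambda>s. f s \<omega>"] N
            range_size_pos[OF n_pos, of "\<lambda>s. f s \<omega>" r] by simp
        let ?c = "card {s \<in> {1..r}. range_size n (\<lambda>s. f s \<omega>) s \<in> {2..K}}"
        have "exp (\<i> * complex_of_real (t * real ?c)) = z ^ ?c"
          unfolding z_def exp_of_nat_mult[symmetric] by (simp add: algebra_simps)
        then show ?thesis
          unfolding Y_def X_def path_weight_eq_power[OF r assms] sum_tau_eq_card[OF r] r
          by (simp add: path_gf.simps)
      qed
      then show "(\<lambda>N. Y N \<omega>) \<longlonglongrightarrow> X \<omega>"
        by (intro tendsto_eventually) (auto simp: eventually_sequentially)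
    qed
  qed
  moreover have "(\<integral>\<omega>. Y N \<omega> \<partial>M) = path_gf n K z n" for N
    unfolding Y
    using n_pos sum_path_weight_mult_path_gf[OF n_pos z, of K N]
      expectation_initial_maps[of "\<lambda>a. path_weight n K z a N * path_gf n K z (range_size n a N)" N]
    by simp
  ultimately have "(\<integral>\<omega>. X \<omega> \<partial>M) = path_gf n K z n"
    by (simp add: LIMSEQ_const_iff)
  then show ?thesis unfolding X_def z_def .
qed

end

section \<open>Conditioning and the final quotient\<close>

lemma xi_less:
  assumes "n \<ge> 2" "\<xi> n \<ge> 1"
  shows "nat (\<xi> n) < n"
proof -
  have "real_of_int (\<xi> n) \<le> ln (ln n)" unfolding \<xi>_def by (rule of_int_floor_le)
  also have "\<dots> \<le> ln n - 1" using assms by (intro ln_le_minus_one) auto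
  also have "\<dots> \<le> real n - 1 - 1" using assms by (intro diff_right_mono ln_le_minus_one) auto
  finally show ?thesis using assms by linarith
qed

lemma expectation_given_eq_divide:
  assumes "A \<in> sets M" "X \<in> borel_measurable M" "measure M A > 0"
  shows "expectation_given M X A = (\<integral>\<omega>. indicator A \<omega> * X \<omega> \<partial>M) / measure M A"
proof -
  \<comment> \<open>A set of infinite \<open>emeasure\<close> has \<open>measure\<close> 0 by
    convention, so positivity gives finiteness.\<close>
  have em: "emeasure M A = ennreal (measure M A)"
    using assms(3)
    by (metis emeasure_eq_ennreal_measure measure_def enn2real_top less_irrefl)
  have "uniform_measure M A = density M (\<lambda>\<omega>. ennreal (indicator A \<omega> / measure M A))"
    unfolding uniform_measure_def em using assms
    by (intro arg_cong[where f = "density M"] ext)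
      (auto simp: indicator_def divide_ennreal simp flip: ennreal_1)
  then have "expectation_given M X A = (\<integral>\<omega>. (indicator A \<omega> / measure M A) *\<^sub>R X \<omega> \<partial>M)"
    unfolding expectation_given_def using assms
    by (simp only:) (subst integral_density, auto)
  also have "\<dots> = (\<integral>\<omega>. (indicator A \<omega> * X \<omega>) / measure M A \<partial>M)"
    by (intro Bochner_Integration.integral_cong) (auto simp: indicator_def scaleR_conv_of_real)
  also have "\<dots> = (\<integral>\<omega>. indicator A \<omega> * X \<omega> \<partial>M) / measure M A"
    by simp
  finally show ?thesis .
qed

theorem theorem2:
  fixes M :: "'a measure" and n :: nat and f :: "nat \<Rightarrow> 'a \<Rightarrow> nat \<Rightarrow> nat" and t :: real
  assumes "prob_space M"
    and "n \<ge> 2"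
    and "\<xi> n \<ge> 1"
    and "prob_space.indep_vars M (\<lambda>_. count_space (self_maps n)) f {1..}"
    and "\<And>s. s \<ge> 1 \<Longrightarrow>
      distr M (count_space (self_maps n)) (f s) = uniform_count_measure (self_maps n)"
    and "measure M (all_visited M n f) > 0"
  shows "expectation_given M
      (\<lambda>\<omega>. exp (\<i> * complex_of_real (t * enn2real (T\<^sub>1 n (\<lambda>s. f s \<omega>))))) (all_visited M n f)
    = exp (\<i> * complex_of_real (t * real_of_int (\<xi> n - 1))) *
      (\<Prod>k = 2..nat (\<xi> n).
        (1 - complex_of_real (lam n k)) /
        (1 - complex_of_real (lam n k) * exp (\<i> * complex_of_real t)))"
proof -
  interpret random_self_maps M n f
    using assms by (intro random_self_maps.intro random_self_maps_axioms.intro) auto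
  define K where "K = nat (\<xi> n)"
  define z where "z = exp (\<i> * complex_of_real t)"
  have K: "1 \<le> K" "K < n" using assms(2,3) xi_less by (auto simp: K_def)
  let ?A = "all_visited M n f"
  \<comment> \<open>A nonmeasurable set has \<open>measure\<close> 0 by convention, so positivity of
    the probability already yields measurability.\<close>
  have A: "?A \<in> events" using assms(6) measure_notin_sets by fastforce
  have ind: "indicator ?A \<omega> = of_bool (\<forall>m\<in>{1..K}. \<tau> n (\<lambda>s. f s \<omega>) m > 0)" if "\<omega> \<in> space M" for \<omega>
    using that by (auto simp: all_visited_def K_def indicator_def)
  have E: "(\<integral>\<omega>. indicator ?A \<omega> * exp (\<i> * complex_of_real (u * enn2real (T\<^sub>1 n (\<lambda>s. f s \<omega>)))) \<partial>M) =
      path_gf n K (exp (\<i> * u)) n" for u :: real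
    unfolding expectation_exp_sum_tau[OF K(2), symmetric] T\<^sub>1_def K_def[symmetric]
    by (intro Bochner_Integration.integral_cong) (auto simp: ind)
  \<comment> \<open>Taking \<open>u = 0\<close> in \<open>E\<close>, that is \<open>z = 1\<close>,
    makes the normalising probability a value of the same generating function.\<close>
  have P: "complex_of_real (prob ?A) = path_gf n K 1 n"
  proof -
    have "complex_of_real (prob ?A) = (\<integral>\<omega>. complex_of_real (indicator ?A \<omega>) \<partial>M)"
      using A by simp
    then show ?thesis using E[of 0] by (simp add: of_real_indicator)
  qed
  obtain c where c: "\<And>z. path_gf n K z n = c * (visit_weight K z K * path_gf n K z K)"
    using path_gf_above_threshold[OF K order.refl] by blast
  let ?Q = "\<Prod>m = 2..K. complex_of_real (trans_prob n m (m - 1))"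
  have gf: "path_gf n K w n = c * (w ^ (K - 1) * (?Q / (\<Prod>m = 2..K. 1 - lam n m * w)))" for w :: complex
    unfolding c path_gf_below_threshold[OF K(1) order.refl] by (simp add: prod_dividef)
  have nz: "(\<Prod>m = 2..K. 1 - complex_of_real (lam n m) * w) \<noteq> 0" if "norm w = 1" for w
  proof -
    have "\<forall>m\<in>{2..K}. 1 - complex_of_real (lam n m) * w \<noteq> 0"
      using that K by (intro ballI one_minus_lam_mult_nonzero) auto
    then show ?thesis by (simp only: prod_zero_iff finite_atLeastAtMost) blast
  qed
  \<comment> \<open>Positive probability of the event forces \<open>c\<close> and \<open>?Q\<close>
    to be nonzero, so that both cancel in the quotient.\<close>
  have gf1: "path_gf n K 1 n \<noteq> 0" unfolding P[symmetric] using assms(6) by simp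
  have "c \<noteq> 0" using gf1 unfolding gf[of 1] by (rule contrapos_nn) (simp only: mult_zero_left)
  have "?Q \<noteq> 0" using gf1 unfolding gf[of 1] by (rule contrapos_nn) (simp only: div_0 mult_zero_right)
  have "expectation_given M
      (\<lambda>\<omega>. exp (\<i> * complex_of_real (t * enn2real (T\<^sub>1 n (\<lambda>s. f s \<omega>))))) ?A =
      path_gf n K z n / path_gf n K 1 n"
    using A assms(6) unfolding P[symmetric] z_def E[symmetric]
    by (intro expectation_given_eq_divide) (auto simp: T\<^sub>1_def)
  also have "\<dots> = z ^ (K - 1) * ((\<Prod>m = 2..K. 1 - lam n m) / (\<Prod>m = 2..K. 1 - lam n m * z))"
    unfolding gf using \<open>c \<noteq> 0\<close> \<open>?Q \<noteq> 0\<close> nz[of 1] nz[of z]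
    by (simp add: z_def)
  also have "z ^ (K - 1) = exp (\<i> * complex_of_real (t * real_of_int (\<xi> n - 1)))"
  proof -
    have "real_of_int (\<xi> n - 1) = real (K - 1)" using assms(3) by (simp add: K_def)
    then show ?thesis unfolding z_def exp_of_nat_mult[symmetric] by (simp add: algebra_simps)
  qed
  finally show ?thesis by (simp add: K_def z_def prod_dividef)
qed

end
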